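(* Assume $N=2n+1$ is odd. Then $G^{\theta}\simeq Sp(V)$ and $G^{\iota\theta}_{\mathrm{uni}}\simeq\mathfrak g^{\theta}_{\mathrm{nil}}$. Under the embedding $\mathfrak{sp}(V)_{\mathrm{nil}}\hookrightarrow\mathfrak g^{\theta}_{\mathrm{nil}}$, the set $\mathfrak{sp}(V)_{\mathrm{nil}}$ is a $G^{\theta}$-stable subset of $\mathfrak g^{\theta}_{\mathrm{nil}}$, and the action of $G^{\theta}$ on $\mathfrak{sp}(V)_{\mathrm{nil}}$ coincides with the conjugation action of $Sp(V)$ on it.
   Context: $\mathbf k$ is an algebraically closed field of characteristic $2$, $n\ge1$, $N=2n+1$. $V'$ is a vector space with basis $e_0,e_1,\dots,e_n,f_1,\dots,f_n$, $G=GL(V')=GL_N$ via this basis, $\mathfrak g=\mathfrak{gl}_N$, and $V\subset V'$ is the span of $e_1,\dots,e_n,f_1,\dots,f_n$. Let $J=\begin{pmatrix}1&0&0\\0&0&1_n\\0&1_n&0\end{pmatrix}$ and let $\theta:G\to G$ be the involution $\theta(g)=J^{-1}({}^tg^{-1})J$, inducing $\theta(x)=J({}^tx)J$ on $\mathfrak g$. Notation: $G^\theta=\{g:\theta(g)=g\}$; $G^{\iota\theta}=\{g\in G:\theta(g)=g^{-1}\}$ and $G^{\iota\theta}_{\mathrm{uni}}$ is its subset of unipotent elements; $\mathfrak g^\theta=\{x\in\mathfrak g:\theta(x)=x\}$ and $\mathfrak g^\theta_{\mathrm{nil}}$ is its subset of nilpotent elements. $Sp(V)=\{y\in GL_{2n}:{}^tyJ_0y=J_0\}$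 with $J_0=\begin{pmatrix}0&1_n\\1_n&0\end{pmatrix}$, and $\mathfrak{sp}(V)$ is its Lie algebra, with nilpotent elements $\mathfrak{sp}(V)_{\mathrm{nil}}$. The group isomorphism identifies $y\in Sp(V)$ with $\begin{pmatrix}1&0\\0&y\end{pmatrix}$, and the embedding $\mathfrak{sp}(V)\hookrightarrow\mathfrak g^\theta$ is $x\mapsto\begin{pmatrix}0&0\\0&x\end{pmatrix}$. *)

theory Defs
  imports
    "HOL-Algebra.Group"
    "HOL-Computational_Algebra.Polynomial"
    "Jordan_Normal_Form.Matrix"
begin

text \<open>
  All varieties here are sets of square matrices, viewed as subsets of affine space with the
  matrix entries as coordinates.  Over an infinite field polynomial functions may be used in
  place of polynomials.
\<close>

inductive_set poly_funs :: "nat \<Rightarrow> ('a :: field mat \<Rightarrow> 'a) set" for d :: nat where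
  const: "(\<lambda>_. c) \<in> poly_funs d"
| coord: "i < d \<Longrightarrow> j < d \<Longrightarrow> (\<lambda>x. x $$ (i, j)) \<in> poly_funs d"
| add: "P \<in> poly_funs d \<Longrightarrow> Q \<in> poly_funs d \<Longrightarrow> (\<lambda>x. P x + Q x) \<in> poly_funs d"
| mult: "P \<in> poly_funs d \<Longrightarrow> Q \<in> poly_funs d \<Longrightarrow> (\<lambda>x. P x * Q x) \<in> poly_funs d"

text \<open>
  Regular functions on a subset of affine space are those that are locally (in the Zariski
  topology) quotients of polynomials.  This covers closed subsets of the general linear group,
  on which the inverse of the determinant is regular.
\<close>

definition regular_on :: "nat \<Rightarrow> 'a :: field mat set \<Rightarrow> ('a mat \<Rightarrow> 'a) \<Rightarrow> bool" where
  "regular_on d X h \<longleftrightarrow>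
     (\<forall>p\<in>X. \<exists>P\<in>poly_funs d. \<exists>Q\<in>poly_funs d.
        Q p \<noteq> 0 \<and> (\<forall>q\<in>X. Q q \<noteq> 0 \<longrightarrow> h q = P q / Q q))"

definition variety_morphism ::
    "nat \<Rightarrow> 'a :: field mat set \<Rightarrow> nat \<Rightarrow> 'a mat set \<Rightarrow> ('a mat \<Rightarrow> 'a mat) \<Rightarrow> bool" where
  "variety_morphism d X e Y f \<longleftrightarrow>
     X \<subseteq> carrier_mat d d \<and> Y \<subseteq> carrier_mat e e \<and> f ` X \<subseteq> Y \<and>
     (\<forall>i<e. \<forall>j<e. regular_on d X (\<lambda>x. f x $$ (i, j)))"

definition variety_iso ::
    "nat \<Rightarrow> 'a :: field mat set \<Rightarrow> nat \<Rightarrow> 'a mat set \<Rightarrow> ('a mat \<Rightarrow> 'a mat) \<Rightarrow> bool" where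
  "variety_iso d X e Y f \<longleftrightarrow>
     variety_morphism d X e Y f \<and>
     (\<exists>g. variety_morphism e Y d X g \<and> (\<forall>x\<in>X. g (f x) = x) \<and> (\<forall>y\<in>Y. f (g y) = y))"

definition GL :: "nat \<Rightarrow> 'a :: field mat monoid" where
  "GL d = units_of (ring_mat TYPE('a) d ())"

definition conj_action :: "nat \<Rightarrow> 'a :: field mat \<Rightarrow> 'a mat \<Rightarrow> 'a mat" where
  "conj_action d g x = g * x * inv\<^bsub>GL d\<^esub> g"

definition algebraic_group_iso ::
    "nat \<Rightarrow> 'a :: field mat set \<Rightarrow> nat \<Rightarrow> 'a mat set \<Rightarrow> ('a mat \<Rightarrow> 'a mat) \<Rightarrow> bool" where
  "algebraic_group_iso d H e K f \<longleftrightarrow>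
     subgroup H (GL d) \<and> subgroup K (GL e) \<and>
     f \<in> iso ((GL d)\<lparr>carrier := H\<rparr>) ((GL e)\<lparr>carrier := K\<rparr>) \<and>
     variety_iso d H e K f"

definition equivariant_variety_iso ::
    "nat \<Rightarrow> 'a :: field mat set \<Rightarrow> 'a mat set \<Rightarrow> 'a mat set \<Rightarrow> ('a mat \<Rightarrow> 'a mat) \<Rightarrow> bool" where
  "equivariant_variety_iso d H X Y f \<longleftrightarrow>
     variety_iso d X d Y f \<and>
     (\<forall>g\<in>H. \<forall>x\<in>X. conj_action d g x \<in> X) \<and>
     (\<forall>g\<in>H. \<forall>y\<in>Y. conj_action d g y \<in> Y) \<and>
     (\<forall>g\<in>H. \<forall>x\<in>X. f (conj_action d g x) = conj_action d g (f x))"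

text \<open>
  The Lie algebra of a closed matrix group \<open>H\<close> is its tangent space at the identity, i.e. the
  space of point derivations at \<open>1\<close> of the coordinate ring.  The first condition below says that
  \<open>D\<close> descends to functions on \<open>H\<close>; a derivation \<open>D\<close> is identified with the matrix of
  its values on the coordinate functions.
\<close>

definition point_derivation_at_one ::
    "nat \<Rightarrow> 'a :: field mat set \<Rightarrow> (('a mat \<Rightarrow> 'a) \<Rightarrow> 'a) \<Rightarrow> bool" where
  "point_derivation_at_one d H D \<longleftrightarrow>
     (\<forall>P\<in>poly_funs d. \<forall>Q\<in>poly_funs d. (\<forall>h\<in>H. P h = Q h) \<longrightarrow> D P = D Q) \<and>
     (\<forall>P\<in>poly_funs d. \<forall>Q\<in>poly_funs d. D (\<lambda>x. P x + Q x) = D P + D Q) \<and>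
     (\<forall>c. \<forall>P\<in>poly_funs d. D (\<lambda>x. c * P x) = c * D P) \<and>
     (\<forall>P\<in>poly_funs d. \<forall>Q\<in>poly_funs d.
        D (\<lambda>x. P x * Q x) = D P * Q (1\<^sub>m d) + P (1\<^sub>m d) * D Q)"

definition lie_algebra :: "nat \<Rightarrow> 'a :: field mat set \<Rightarrow> 'a mat set" where
  "lie_algebra d H =
     {x \<in> carrier_mat d d. \<exists>D. point_derivation_at_one d H D \<and>
        (\<forall>i<d. \<forall>j<d. x $$ (i, j) = D (\<lambda>y. y $$ (i, j)))}"

definition nilpotent_mat :: "nat \<Rightarrow> 'a :: field mat \<Rightarrow> bool" where
  "nilpotent_mat d x \<longleftrightarrow> (\<exists>m. x ^\<^sub>m m = 0\<^sub>m d d)"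

definition unipotent_mat :: "nat \<Rightarrow> 'a :: field mat \<Rightarrow> bool" where
  "unipotent_mat d g \<longleftrightarrow> nilpotent_mat d (g - 1\<^sub>m d)"

text \<open>
  The basis of \<open>V'\<close> is ordered as \<open>e\<^sub>0, e\<^sub>1, \<dots>, e\<^sub>n, f\<^sub>1, \<dots>, f\<^sub>n\<close>, so that
  \<open>diag_block n c y\<close> is the matrix with blocks \<open>c\<close> on \<open>e\<^sub>0\<close> and \<open>y\<close> on \<open>V\<close>.
\<close>

definition diag_block :: "nat \<Rightarrow> 'a :: field \<Rightarrow> 'a mat \<Rightarrow> 'a mat" where
  "diag_block n c y =
     four_block_mat (c \<cdot>\<^sub>m 1\<^sub>m 1) (0\<^sub>m 1 (2 * n)) (0\<^sub>m (2 * n) 1) y"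

definition J0 :: "nat \<Rightarrow> 'a :: field mat" where
  "J0 n = four_block_mat (0\<^sub>m n n) (1\<^sub>m n) (1\<^sub>m n) (0\<^sub>m n n)"

definition J :: "nat \<Rightarrow> 'a :: field mat" where
  "J n = diag_block n 1 (J0 n)"

definition theta :: "nat \<Rightarrow> 'a :: field mat \<Rightarrow> 'a mat" where
  "theta n g =
     (inv\<^bsub>GL (2 * n + 1)\<^esub> (J n)) * transpose_mat (inv\<^bsub>GL (2 * n + 1)\<^esub> g) * J n"

definition theta_lie :: "nat \<Rightarrow> 'a :: field mat \<Rightarrow> 'a mat" where
  "theta_lie n x = J n * transpose_mat x * J n"

definition G_theta :: "nat \<Rightarrow> 'a :: field mat set" where
  "G_theta n = {g \<in> carrier (GL (2 * n + 1)). theta n g = g}"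

definition G_iota_theta :: "nat \<Rightarrow> 'a :: field mat set" where
  "G_iota_theta n = {g \<in> carrier (GL (2 * n + 1)). theta n g = inv\<^bsub>GL (2 * n + 1)\<^esub> g}"

definition G_iota_theta_uni :: "nat \<Rightarrow> 'a :: field mat set" where
  "G_iota_theta_uni n = {g \<in> G_iota_theta n. unipotent_mat (2 * n + 1) g}"

definition g_theta :: "nat \<Rightarrow> 'a :: field mat set" where
  "g_theta n = {x \<in> carrier_mat (2 * n + 1) (2 * n + 1). theta_lie n x = x}"

definition g_theta_nil :: "nat \<Rightarrow> 'a :: field mat set" where
  "g_theta_nil n = {x \<in> g_theta n. nilpotent_mat (2 * n + 1) x}"

definition Sp :: "nat \<Rightarrow> 'a :: field mat set" where
  "Sp n = {y \<in> carrier (GL (2 * n)). transpose_mat y * J0 n * y = J0 n}"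

definition sp :: "nat \<Rightarrow> 'a :: field mat set" where
  "sp n = lie_algebra (2 * n) (Sp n)"

definition sp_nil :: "nat \<Rightarrow> 'a :: field mat set" where
  "sp_nil n = {x \<in> sp n. nilpotent_mat (2 * n) x}"

end

(* In characteristic 2 the form J0 is alternating, so the form J satisfies <v,v> = v_0^2.  An
   isometry of J thus preserves the coordinate v_0, hence V and the orthogonal complement of V,
   which is the line of e_0; it is therefore diag(1, y) with y in Sp(V).  Since theta(g) is the
   inverse of the image of g under the linear involution x |-> J x^t J, the condition
   theta(g) = g^-1 says that this involution fixes g, and g |-> g - 1 is the equivariant
   isomorphism onto the nilpotent fixed points.  Differentiating y^t J0 y = J0 shows that x in
   sp(V) satisfies J0 x^t J0 = -x = x. *)

theory Submission
  imports Defs "Jordan_Normal_Form.Determinant"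
begin

section \<open>The general linear group\<close>

text \<open>The Lie algebra \<open>sp n\<close> is the tangent space of a point set, not the
  solution set of given equations. Differentiating \<open>transpose_mat y * J0 n * y = J0 n\<close>
  shows that tangent vectors satisfy the linearized equation, and this inclusion yields the
  embedding into \<open>g_theta n\<close>. Deriving stability of \<open>sp n\<close> under
  conjugation from the linearized equation would also call for the converse inclusion. Instead,
  point derivations are transported along conjugation, which maps \<open>Sp n\<close> to itself.
  Characteristic 2 enters at three places: the form \<open>J0 n\<close> takes the value 0 on every
  pair (v, v), the equation a^2 = 1 has the single root 1, and the sign in the linearized equation
  disappears. In odd characteristic the same \<open>J n\<close> would define an orthogonal group,
  which does not preserve V.\<close>

lemma GL_carrierD: "g \<in> carrier (GL d) \<Longrightarrow> g \<in> carrier_mat d d"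
  unfolding GL_def units_of_def Units_def by (auto simp: ring_mat_simps)

lemma group_GL: "group (GL d :: 'a :: field mat monoid)"
proof -
  interpret semiring "ring_mat TYPE('a) d ()" by (rule semiring_mat)
  show ?thesis unfolding GL_def by (rule units_group)
qed

lemma GL_one: "\<one>\<^bsub>GL d\<^esub> = 1\<^sub>m d"
  and GL_mult: "x \<otimes>\<^bsub>GL d\<^esub> y = x * y"
  by (simp_all add: GL_def units_of_def ring_mat_simps)

lemma GL_inv:
  assumes "g \<in> carrier (GL d)"
  shows "inv\<^bsub>GL d\<^esub> g \<in> carrier (GL d)"
    and "inv\<^bsub>GL d\<^esub> g * g = 1\<^sub>m d" "g * inv\<^bsub>GL d\<^esub> g = 1\<^sub>m d"
  using group.inv_closed[OF group_GL assms] group.l_inv[OF group_GL assms]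
    group.r_inv[OF group_GL assms] by (simp_all add: GL_one GL_mult)

lemma GL_right_inverse:
  fixes g h :: "'a :: field mat"
  assumes g: "g \<in> carrier_mat d d" and h: "h \<in> carrier_mat d d" and gh: "g * h = 1\<^sub>m d"
  shows "g \<in> carrier (GL d)" "inv\<^bsub>GL d\<^esub> g = h"
proof -
  have hg: "h * g = 1\<^sub>m d" by (rule mat_mult_left_right_inverse[OF g h gh])
  show G: "g \<in> carrier (GL d)"
    using g h gh hg unfolding GL_def units_of_def Units_def by (auto simp: ring_mat_simps)
  have H: "h \<in> carrier (GL d)"
    using g h gh hg unfolding GL_def units_of_def Units_def by (auto simp: ring_mat_simps)
  show "inv\<^bsub>GL d\<^esub> g = h"
    using group.inv_equality[OF group_GL _ G H] hg by (simp add: GL_one GL_mult)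
qed

text \<open>Made for rewriting: once products are associated to the right, an inverse pair in the
  middle appears as \<open>g * (h * x)\<close>.\<close>

lemma mult_mat_cancel_left:
  fixes g h x :: "'a :: semiring_1 mat"
  assumes "g \<in> carrier_mat d d" "h \<in> carrier_mat d d" "x \<in> carrier_mat d d"
    and "g * h = 1\<^sub>m d"
  shows "g * (h * x) = x"
  using assms left_mult_one_mat[of x d d] assoc_mult_mat[of g d d h d x d] by metis

text \<open>One argument serves both groups: \<open>Sp n\<close> with \<open>J0 n\<close>, and
  \<open>G_theta n\<close> with \<open>J n\<close> after \<open>G_theta_isometry\<close>.\<close>

lemma subgroup_isometry:
  fixes S :: "'a :: field mat"
  assumes S: "S \<in> carrier_mat d d"
  shows "subgroup {g \<in> carrier (GL d). transpose_mat g * S * g = S} (GL d)"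
proof (rule group.subgroupI[OF group_GL])
  show "{g \<in> carrier (GL d). transpose_mat g * S * g = S} \<noteq> {}"
    using GL_right_inverse(1)[of "1\<^sub>m d" d "1\<^sub>m d"] S by (auto intro!: exI[of _ "1\<^sub>m d"])
next
  fix g assume "g \<in> {g \<in> carrier (GL d). transpose_mat g * S * g = S}"
  then have g: "g \<in> carrier (GL d)" and gS: "transpose_mat g * S * g = S" by auto
  define h where "h = inv\<^bsub>GL d\<^esub> g"
  have c: "g \<in> carrier_mat d d" "h \<in> carrier_mat d d" and i: "g * h = 1\<^sub>m d"
    using g GL_inv[OF g] GL_carrierD unfolding h_def by auto
  have t: "transpose_mat h * transpose_mat g = 1\<^sub>m d"
    using transpose_mult[OF c] i by simp
  have "transpose_mat h * S * h = transpose_mat h * (transpose_mat g * S * g) * h"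
    by (simp add: gS)
  also have "\<dots> = transpose_mat h * (transpose_mat g * (S * (g * h)))"
    using c S by (simp add: assoc_mult_mat[of _ d d _ d _ d])
  also have "\<dots> = S"
    using c S t by (simp add: i mult_mat_cancel_left[of _ d])
  finally show "inv\<^bsub>GL d\<^esub> g \<in> {g \<in> carrier (GL d). transpose_mat g * S * g = S}"
    using GL_inv(1)[OF g] by (simp add: h_def)
next
  fix g h
  assume "g \<in> {g \<in> carrier (GL d). transpose_mat g * S * g = S}"
    and "h \<in> {g \<in> carrier (GL d). transpose_mat g * S * g = S}"
  then have g: "g \<in> carrier (GL d)" "transpose_mat g * S * g = S"
    and h: "h \<in> carrier (GL d)" "transpose_mat h * S * h = S" by auto
  note c = g(1)[THEN GL_carrierD] h(1)[THEN GL_carrierD]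
  have "transpose_mat (g * h) * S * (g * h) = transpose_mat h * (transpose_mat g * S * g) * h"
    using c S by (simp add: transpose_mult[of _ d d] assoc_mult_mat[of _ d d _ d _ d])
  then have "transpose_mat (g * h) * S * (g * h) = S" by (simp add: g h)
  moreover have "g * h \<in> carrier (GL d)"
    using monoid.m_closed[OF group.is_monoid[OF group_GL] g(1) h(1)] by (simp add: GL_mult)
  ultimately show "g \<otimes>\<^bsub>GL d\<^esub> h \<in> {g \<in> carrier (GL d). transpose_mat g * S * g = S}"
    by (simp add: GL_mult)
qed auto

lemma conj_action_carrier:
  assumes "g \<in> carrier (GL d)" "x \<in> carrier_mat d d"
  shows "conj_action d g x \<in> carrier_mat d d"
  using assms GL_inv(1)[OF assms(1)] unfolding conj_action_def by (auto dest!: GL_carrierD)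

lemma nilpotent_conj_action:
  assumes g: "g \<in> carrier (GL d)" and x: "x \<in> carrier_mat d d" and nil: "nilpotent_mat d x"
  shows "nilpotent_mat d (conj_action d g x)"
proof -
  obtain m where m: "x ^\<^sub>m m = 0\<^sub>m d d" using nil by (auto simp: nilpotent_mat_def)
  have c: "g \<in> carrier_mat d d" "inv\<^bsub>GL d\<^esub> g \<in> carrier_mat d d"
    using GL_inv(1)[OF g] g by (auto dest: GL_carrierD)
  have "similar_mat_wit (conj_action d g x) x g (inv\<^bsub>GL d\<^esub> g)"
    using GL_inv[OF g] c x conj_action_carrier[OF g x]
    by (intro similar_mat_witI[of _ _ d]) (auto simp: conj_action_def)
  from similar_mat_wit_pow_id[OF this, of m] have "conj_action d g x ^\<^sub>m m = 0\<^sub>m d d"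
    using c m by simp
  then show ?thesis by (auto simp: nilpotent_mat_def)
qed

lemma conj_action_minus_one:
  assumes g: "g \<in> carrier (GL d)" and x: "x \<in> carrier_mat d d"
  shows "conj_action d g (x - 1\<^sub>m d) = conj_action d g x - 1\<^sub>m d"
proof -
  have c: "g \<in> carrier_mat d d" "inv\<^bsub>GL d\<^esub> g \<in> carrier_mat d d"
    using GL_inv(1)[OF g] g by (auto dest: GL_carrierD)
  then show ?thesis
    using x GL_inv(3)[OF g] unfolding conj_action_def
    by (simp add: mult_minus_distrib_mat[of _ d d _ d] minus_mult_distrib_mat[of _ d d _ _ d])
qed

text \<open>The inverse is the geometric series in -x, which terminates. This is what brings y + 1
  back into the group when y is nilpotent.\<close>

lemma one_plus_nilpotent_unit:
  fixes x :: "'a :: field mat"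
  assumes x: "x \<in> carrier_mat d d" and nil: "nilpotent_mat d x"
  shows "x + 1\<^sub>m d \<in> carrier (GL d)"
proof -
  \<comment> \<open>Here s is the partial sum of (-x)^k over k < m, and c is the sign -(-1)^m.
    Leaving c existential avoids tracking it.\<close>
  have "\<exists>s\<in>carrier_mat d d. \<exists>c. (x + 1\<^sub>m d) * s = 1\<^sub>m d + c \<cdot>\<^sub>m x ^\<^sub>m m" for m
  proof (induction m)
    case 0
    show ?case using x by (intro bexI[of _ "0\<^sub>m d d"] exI[of _ "-1"]) auto
  next
    case (Suc m)
    then obtain s c where s: "s \<in> carrier_mat d d"
      and eq: "(x + 1\<^sub>m d) * s = 1\<^sub>m d + c \<cdot>\<^sub>m x ^\<^sub>m m" by blast
    have p: "x ^\<^sub>m m \<in> carrier_mat d d" using x by simp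
    \<comment> \<open>Powers grow by multiplication on the right, while the factor x + 1 contributes
      x on the left.\<close>
    have comm: "x * x ^\<^sub>m m = x ^\<^sub>m m * x"
    proof (induction m)
      case (Suc m)
      have "x * (x ^\<^sub>m m * x) = x * x ^\<^sub>m m * x"
        using x by (simp add: assoc_mult_mat[of x d d "x ^\<^sub>m m" d x d])
      then show ?case by (simp add: Suc)
    qed (use x in simp)
    have "(x + 1\<^sub>m d) * (s - c \<cdot>\<^sub>m x ^\<^sub>m m)
        = (x + 1\<^sub>m d) * s - (x + 1\<^sub>m d) * (c \<cdot>\<^sub>m x ^\<^sub>m m)"
      using x s p by (simp add: mult_minus_distrib_mat[of _ d d _ d])
    also have "(x + 1\<^sub>m d) * (c \<cdot>\<^sub>m x ^\<^sub>m m) = c \<cdot>\<^sub>m (x ^\<^sub>m m * x) + c \<cdot>\<^sub>m x ^\<^sub>m m"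
      using x p by (simp add: add_mult_distrib_mat[of _ d d _ _ d] mult_smult_distrib[of _ d d _ d] comm
        add_smult_distrib_left_mat[of _ d d] mult_carrier_mat[of _ d d])
    also have "(x + 1\<^sub>m d) * s - \<dots> = 1\<^sub>m d + (- c) \<cdot>\<^sub>m x ^\<^sub>m Suc m"
      unfolding eq using x p by (intro eq_matI) auto
    finally show ?case using s p x
      by (intro bexI[of _ "s - c \<cdot>\<^sub>m x ^\<^sub>m m"] exI[of _ "-c"]) auto
  qed
  then obtain s where "s \<in> carrier_mat d d" "(x + 1\<^sub>m d) * s = 1\<^sub>m d"
    using nil unfolding nilpotent_mat_def by (metis right_add_zero_mat smult_zero_mat one_carrier_mat)
  then show ?thesis using GL_right_inverse(1)[of "x + 1\<^sub>m d" d s] x by simp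
qed

section \<open>Regular functions and point derivations\<close>

text \<open>All maps shown to be isomorphisms below, and their inverses, have polynomial entries, so
  the denominator 1 always suffices.\<close>

lemma regular_on_poly:
  assumes "P \<in> poly_funs d" "\<And>x. x \<in> X \<Longrightarrow> h x = P x"
  shows "regular_on d X h"
  unfolding regular_on_def
  using assms by (intro ballI bexI[of _ P] bexI[of _ "\<lambda>_. 1"]) (auto intro: poly_funs.const)

lemma poly_funs_sum:
  assumes "finite A" "\<And>k. k \<in> A \<Longrightarrow> P k \<in> poly_funs d"
  shows "(\<lambda>x. \<Sum>k\<in>A. P k x) \<in> poly_funs d"
  using assms by (induction A) (auto intro: poly_funs.intros)

lemma
  assumes "point_derivation_at_one d H D"
  shows point_derivation_cong:
      "\<lbrakk>P \<in> poly_funs d; Q \<in> poly_funs d; \<And>h. h \<in> H \<Longrightarrow> P h = Q h\<rbrakk> \<Longrightarrow> D P = D Q"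
    and point_derivation_add:
      "\<lbrakk>P \<in> poly_funs d; Q \<in> poly_funs d\<rbrakk> \<Longrightarrow> D (\<lambda>x. P x + Q x) = D P + D Q"
    and point_derivation_scale:
      "P \<in> poly_funs d \<Longrightarrow> D (\<lambda>x. c * P x) = c * D P"
    and point_derivation_mult:
      "\<lbrakk>P \<in> poly_funs d; Q \<in> poly_funs d\<rbrakk>
        \<Longrightarrow> D (\<lambda>x. P x * Q x) = D P * Q (1\<^sub>m d) + P (1\<^sub>m d) * D Q"
  using assms unfolding point_derivation_at_one_def by blast+

lemma point_derivation_sum:
  assumes D: "point_derivation_at_one d H D"
    and "finite A" "\<And>k. k \<in> A \<Longrightarrow> P k \<in> poly_funs d"
  shows "D (\<lambda>x. \<Sum>k\<in>A. P k x) = (\<Sum>k\<in>A. D (P k))"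
  using assms(2,3)
proof (induction A)
  case empty
  from point_derivation_scale[OF D poly_funs.const, of 0 0] show ?case by simp
next
  case (insert a A)
  then show ?case
    using point_derivation_add[OF D, of "P a" "\<lambda>x. \<Sum>k\<in>A. P k x"] poly_funs_sum[of A P d] by simp
qed

lemma point_derivation_const:
  assumes D: "point_derivation_at_one d H D"
  shows "D (\<lambda>x. c) = 0"
proof -
  from point_derivation_mult[OF D poly_funs.const poly_funs.const, of 1 1]
  have "D (\<lambda>x. 1) = D (\<lambda>x. 1) + D (\<lambda>x. 1)" by simp
  then have "D (\<lambda>x. 1) = 0" by (simp only: add_cancel_right_right)
  then show ?thesis using point_derivation_scale[OF D poly_funs.const, of c 1] by simp
qed

text \<open>Differentiating \<open>h\<^sup>t S h = S\<close> at the identity.\<close>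

lemma lie_algebra_isometry:
  fixes S :: "'a :: field mat"
  assumes S: "S \<in> carrier_mat d d"
    and H: "H \<subseteq> carrier_mat d d" "\<And>h. h \<in> H \<Longrightarrow> transpose_mat h * S * h = S"
    and x: "x \<in> lie_algebra d H"
  shows "transpose_mat x * S + S * x = 0\<^sub>m d d"
proof -
  obtain D where D: "point_derivation_at_one d H D" and xc: "x \<in> carrier_mat d d"
    and xD: "\<And>i j. i < d \<Longrightarrow> j < d \<Longrightarrow> D (\<lambda>y. y $$ (i, j)) = x $$ (i, j)"
    using x unfolding lie_algebra_def by auto
  have "(transpose_mat x * S + S * x) $$ (i, j) = 0" if i: "i < d" and j: "j < d" for i j
  proof -
    let ?q = "\<lambda>l k h. h $$ (k, i) * h $$ (l, j) :: 'a"
    have q: "?q l k \<in> poly_funs d" if "l < d" "k < d" for l k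
      using that i j by (intro poly_funs.intros)
    \<comment> \<open>The product rule evaluates the undifferentiated factor at the identity, which
      turns it into a Kronecker delta.\<close>
    have Dq: "D (\<lambda>h. S $$ (k, l) * ?q l k h)
        = S $$ (k, l) * (x $$ (k, i) * (if l = j then 1 else 0) + (if k = i then 1 else 0) * x $$ (l, j))"
      if "l < d" "k < d" for l k
    proof -
      have "D (\<lambda>h. S $$ (k, l) * ?q l k h) = S $$ (k, l) * D (?q l k)"
        by (rule point_derivation_scale[OF D q[OF that]])
      also have "D (?q l k) = D (\<lambda>h. h $$ (k, i)) * 1\<^sub>m d $$ (l, j) + 1\<^sub>m d $$ (k, i) * D (\<lambda>h. h $$ (l, j))"
        by (rule point_derivation_mult[OF D poly_funs.coord[OF that(2) i] poly_funs.coord[OF that(1) j]])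
      finally show ?thesis using that i j by (simp add: xD)
    qed
    have Sq: "(\<lambda>h. S $$ (k, l) * ?q l k h) \<in> poly_funs d" if "l < d" "k < d" for l k
      using that i j by (intro poly_funs.intros)
    \<comment> \<open>This is the entry (i, j) of h^t S h, written as a polynomial on matrices of
      every size. It agrees with the matrix product on H, where it is the constant
      \<open>S $$ (i, j)\<close>, and a point derivation depends only on values on H.\<close>
    let ?f = "\<lambda>h. \<Sum>l\<in>{0..<d}. \<Sum>k\<in>{0..<d}. S $$ (k, l) * ?q l k h"
    have fS: "?f h = S $$ (i, j)" if "h \<in> H" for h
    proof -
      have h: "h \<in> carrier_mat d d" using H that by auto
      have "S $$ (i, j) = (transpose_mat h * S * h) $$ (i, j)" using H(2)[OF that] by simp
      also have "\<dots> = ?f h"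
        using h S i j by (simp add: scalar_prod_def sum_distrib_right sum_distrib_left ac_simps
            del: assoc_mult_mat)
      finally show ?thesis by simp
    qed
    have "?f \<in> poly_funs d" using Sq by (intro poly_funs_sum) auto
    then have "D ?f = D (\<lambda>_. S $$ (i, j))"
      by (rule point_derivation_cong[OF D _ poly_funs.const fS])
    also have "\<dots> = 0" by (rule point_derivation_const[OF D])
    finally have "0 = D ?f" by simp
    also have "\<dots> = (\<Sum>l\<in>{0..<d}. D (\<lambda>h. \<Sum>k\<in>{0..<d}. S $$ (k, l) * ?q l k h))"
      using Sq by (intro point_derivation_sum[OF D] poly_funs_sum) auto
    also have "\<dots> = (\<Sum>l\<in>{0..<d}. \<Sum>k\<in>{0..<d}. D (\<lambda>h. S $$ (k, l) * ?q l k h))"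
      using Sq by (intro sum.cong refl point_derivation_sum[OF D]) auto
    also have "\<dots> = (\<Sum>l\<in>{0..<d}. \<Sum>k\<in>{0..<d}. (if l = j then S $$ (k, l) * x $$ (k, i) else 0)
        + (if k = i then S $$ (k, l) * x $$ (l, j) else 0))"
      by (intro sum.cong refl, subst Dq) (auto simp: algebra_simps)
    \<comment> \<open>The two terms of the product rule are separated: one delta fixes l = j and
      leaves x^t S, the other fixes k = i and leaves S x.\<close>
    also have "\<dots> = (\<Sum>l\<in>{0..<d}. if l = j then \<Sum>k\<in>{0..<d}. S $$ (k, l) * x $$ (k, i) else 0)
        + (\<Sum>l\<in>{0..<d}. \<Sum>k\<in>{0..<d}. if k = i then S $$ (k, l) * x $$ (l, j) else 0)"
      by (subst sum.distrib[symmetric], intro sum.cong refl) (auto simp: sum.distrib)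
    also have "\<dots> = (\<Sum>k\<in>{0..<d}. S $$ (k, j) * x $$ (k, i)) + (\<Sum>l\<in>{0..<d}. S $$ (i, l) * x $$ (l, j))"
      using i j by simp
    also have "\<dots> = (transpose_mat x * S + S * x) $$ (i, j)"
      using xc S i j by (simp add: scalar_prod_def ac_simps)
    finally show ?thesis by simp
  qed
  then show ?thesis using xc S by (intro eq_matI) auto
qed

text \<open>If \<open>D\<close> is the derivation of \<open>x\<close>, then \<open>P \<mapsto> D (P \<circ> Ad y)\<close> is the derivation of
  \<open>Ad y x\<close>.  The map \<open>Ad y\<close> is written out in coordinates because membership in
  \<open>poly_funs\<close> also depends on the values at matrices of the wrong size.\<close>

lemma conj_action_lie_algebra:
  fixes H :: "'a :: field mat set"
  assumes y: "y \<in> carrier (GL d)"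
    and H: "H \<subseteq> carrier_mat d d" "\<And>h. h \<in> H \<Longrightarrow> conj_action d y h \<in> H"
    and x: "x \<in> lie_algebra d H"
  shows "conj_action d y x \<in> lie_algebra d H"
proof -
  obtain D where D: "point_derivation_at_one d H D" and xc: "x \<in> carrier_mat d d"
    and xD: "\<And>i j. i < d \<Longrightarrow> j < d \<Longrightarrow> D (\<lambda>y. y $$ (i, j)) = x $$ (i, j)"
    using x unfolding lie_algebra_def by auto
  define z where "z = inv\<^bsub>GL d\<^esub> y"
  have c: "y \<in> carrier_mat d d" "z \<in> carrier_mat d d"
    using GL_inv(1)[OF y] y unfolding z_def by (auto dest: GL_carrierD)
  define A where "A = (\<lambda>h :: 'a mat. mat d d (\<lambda>(i, j).
    \<Sum>l\<in>{0..<d}. \<Sum>k\<in>{0..<d}. y $$ (i, k) * z $$ (l, j) * h $$ (k, l)))"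
  have A: "A h = conj_action d y h" if "h \<in> carrier_mat d d" for h
    unfolding conj_action_def z_def[symmetric] A_def using that c
    by (intro eq_matI) (auto simp: scalar_prod_def sum_distrib_right sum_distrib_left ac_simps simp del: assoc_mult_mat)
  \<comment> \<open>Conjugation fixes the identity, so a derivation at 1 is carried to a derivation
    at the same point.\<close>
  have A1: "A (1\<^sub>m d) = 1\<^sub>m d"
    using c GL_inv(3)[OF y] by (simp add: A conj_action_def z_def[symmetric])
  have tm: "(\<lambda>h. y $$ (i, k) * z $$ (l, j) * h $$ (k, l)) \<in> poly_funs d"
    if "k < d" "l < d" for i j k l
    using that by (intro poly_funs.intros)
  have PA: "(\<lambda>h. P (A h)) \<in> poly_funs d" if "P \<in> poly_funs d" for P
    using that
  proof induction
    case (coord i j)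
    have "(\<lambda>h. \<Sum>l\<in>{0..<d}. \<Sum>k\<in>{0..<d}. y $$ (i, k) * z $$ (l, j) * h $$ (k, l)) \<in> poly_funs d"
      using tm by (intro poly_funs_sum) auto
    then show ?case using coord by (simp add: A_def)
  qed (auto intro: poly_funs.intros)
  define E where "E = (\<lambda>P. D (\<lambda>h. P (A h)))"
  have "point_derivation_at_one d H E"
    unfolding point_derivation_at_one_def E_def
  proof (intro conjI ballI allI impI)
    fix P Q :: "'a mat \<Rightarrow> 'a"
    assume "P \<in> poly_funs d" "Q \<in> poly_funs d"
    note PQ = this[THEN PA]
    show "D (\<lambda>h. P (A h) + Q (A h)) = D (\<lambda>h. P (A h)) + D (\<lambda>h. Q (A h))"
      by (rule point_derivation_add[OF D PQ])
    have "D (\<lambda>h. P (A h) * Q (A h))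
        = D (\<lambda>h. P (A h)) * Q (A (1\<^sub>m d)) + P (A (1\<^sub>m d)) * D (\<lambda>h. Q (A h))"
      by (rule point_derivation_mult[OF D PQ])
    then show "D (\<lambda>h. P (A h) * Q (A h))
        = D (\<lambda>h. P (A h)) * Q (1\<^sub>m d) + P (1\<^sub>m d) * D (\<lambda>h. Q (A h))"
      by (simp add: A1)
    \<comment> \<open>Stability of H enters here: if P and Q agree on H, then so do their composites
      with \<open>A\<close>.\<close>
    assume "\<forall>h\<in>H. P h = Q h"
    then have "P (A h) = Q (A h)" if "h \<in> H" for h using H(1) H(2)[OF that] A[of h] that by auto
    then show "D (\<lambda>h. P (A h)) = D (\<lambda>h. Q (A h))"
      by (rule point_derivation_cong[OF D PQ])
  next
    fix a and P :: "'a mat \<Rightarrow> 'a"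
    assume "P \<in> poly_funs d"
    from PA[OF this] show "D (\<lambda>h. a * P (A h)) = a * D (\<lambda>h. P (A h))"
      by (rule point_derivation_scale[OF D])
  qed
  moreover have "conj_action d y x $$ (i, j) = E (\<lambda>h. h $$ (i, j))" if i: "i < d" and j: "j < d" for i j
  proof -
    have "E (\<lambda>h. h $$ (i, j)) = D (\<lambda>h. \<Sum>l\<in>{0..<d}. \<Sum>k\<in>{0..<d}. y $$ (i, k) * z $$ (l, j) * h $$ (k, l))"
      using i j by (simp add: E_def A_def)
    also have "\<dots> = (\<Sum>l\<in>{0..<d}. D (\<lambda>h. \<Sum>k\<in>{0..<d}. y $$ (i, k) * z $$ (l, j) * h $$ (k, l)))"
      using tm by (intro point_derivation_sum[OF D] poly_funs_sum) auto
    also have "\<dots> = (\<Sum>l\<in>{0..<d}. \<Sum>k\<in>{0..<d}. D (\<lambda>h. y $$ (i, k) * z $$ (l, j) * h $$ (k, l)))"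
      using tm by (intro sum.cong refl point_derivation_sum[OF D]) auto
    also have "\<dots> = (\<Sum>l\<in>{0..<d}. \<Sum>k\<in>{0..<d}. y $$ (i, k) * z $$ (l, j) * x $$ (k, l))"
    proof (intro sum.cong refl)
      fix l k assume "l \<in> {0..<d}" "k \<in> {0..<d}"
      then have kl: "k < d" "l < d" by auto
      have "D (\<lambda>h. y $$ (i, k) * z $$ (l, j) * h $$ (k, l))
          = y $$ (i, k) * z $$ (l, j) * D (\<lambda>h. h $$ (k, l))"
        by (rule point_derivation_scale[OF D poly_funs.coord[OF kl]])
      then show "D (\<lambda>h. y $$ (i, k) * z $$ (l, j) * h $$ (k, l))
          = y $$ (i, k) * z $$ (l, j) * x $$ (k, l)" using xD[OF kl] by simp
    qed
    also have "\<dots> = A x $$ (i, j)" using i j by (simp add: A_def)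
    finally show ?thesis using A[OF xc] by simp
  qed
  ultimately show ?thesis
    using conj_action_carrier[OF y xc] unfolding lie_algebra_def by blast
qed

section \<open>Block matrices and the involution\<close>

lemma diag_block_carrier [simp]:
  "y \<in> carrier_mat (2 * n) (2 * n) \<Longrightarrow> diag_block n c y \<in> carrier_mat (2 * n + 1) (2 * n + 1)"
  unfolding diag_block_def by auto

lemma diag_block_index:
  assumes "y \<in> carrier_mat (2 * n) (2 * n)" "i < 2 * n + 1" "j < 2 * n + 1"
  shows "diag_block n c y $$ (i, j) =
    (if i = 0 \<and> j = 0 then c else if i = 0 \<or> j = 0 then 0 else y $$ (i - 1, j - 1))"
  using assms unfolding diag_block_def by auto

lemma diag_block_mult:
  assumes "x \<in> carrier_mat (2 * n) (2 * n)" "y \<in> carrier_mat (2 * n) (2 * n)"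
  shows "diag_block n a x * diag_block n b y = diag_block n (a * b) (x * y)"
  unfolding diag_block_def
  by (subst mult_four_block_mat[of _ 1 1 _ "2 * n" _ "2 * n" _ _ 1 _ "2 * n"])
    (use assms in \<open>auto intro!: cong_four_block_mat\<close>)

lemma diag_block_transpose:
  "y \<in> carrier_mat (2 * n) (2 * n) \<Longrightarrow>
    transpose_mat (diag_block n c y) = diag_block n c (transpose_mat y)"
  by (intro eq_matI) (auto simp: diag_block_index diag_block_def)

lemma diag_block_one: "diag_block n 1 (1\<^sub>m (2 * n)) = 1\<^sub>m (2 * n + 1)"
  by (intro eq_matI) (auto simp: diag_block_index diag_block_def)

lemma diag_block_zero: "diag_block n 0 (0\<^sub>m (2 * n) (2 * n)) = 0\<^sub>m (2 * n + 1) (2 * n + 1)"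
  by (intro eq_matI) (auto simp: diag_block_index diag_block_def)

lemma diag_block_pow:
  "y \<in> carrier_mat (2 * n) (2 * n) \<Longrightarrow> diag_block n c y ^\<^sub>m m = diag_block n (c ^ m) (y ^\<^sub>m m)"
proof (induction m)
  case 0
  have "dim_row (diag_block n c y) = 2 * n + 1" using diag_block_carrier[OF 0] by blast
  then show ?case using 0 by (simp add: diag_block_one del: add_Suc_right)
qed (simp add: diag_block_mult mult.commute)

text \<open>A left inverse of \<open>diag_block n c\<close> for every corner c. Its entries are
  coordinates of z, so it is visibly a morphism.\<close>

definition lower_block :: "nat \<Rightarrow> 'a mat \<Rightarrow> 'a mat" where
  "lower_block n z = mat (2 * n) (2 * n) (\<lambda>(i, j). z $$ (Suc i, Suc j))"

lemma lower_block_diag_block: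
  "y \<in> carrier_mat (2 * n) (2 * n) \<Longrightarrow> lower_block n (diag_block n c y) = y"
  unfolding lower_block_def by (intro eq_matI) (auto simp: diag_block_index)

text \<open>Used with c = 1 for the groups and with c = 0 for the nilpotent sets.\<close>

lemma variety_iso_diag_block:
  fixes X :: "'a :: field mat set"
  assumes X: "X \<subseteq> carrier_mat (2 * n) (2 * n)"
  shows "variety_iso (2 * n) X (2 * n + 1) (diag_block n c ` X) (diag_block n c)"
proof -
  have "regular_on (2 * n) X (\<lambda>x. diag_block n c x $$ (i, j))"
    if "i < 2 * n + 1" "j < 2 * n + 1" for i j
  proof (rule regular_on_poly)
    \<comment> \<open>The conditions concern only the fixed indices, so in each case the function is
      a constant or a single coordinate.\<close>
    show "(\<lambda>x. if i = 0 \<and> j = 0 then c else if i = 0 \<or> j = 0 then 0 else x $$ (i - 1, j - 1))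
        \<in> poly_funs (2 * n)"
      using that by (cases "i = 0"; cases "j = 0") (auto intro: poly_funs.intros)
  qed (use X that in \<open>auto simp: diag_block_index\<close>)
  moreover have "regular_on (2 * n + 1) (diag_block n c ` X) (\<lambda>x. lower_block n x $$ (i, j))"
    if "i < 2 * n" "j < 2 * n" for i j
    by (rule regular_on_poly[OF poly_funs.coord[of "Suc i" _ "Suc j"]])
      (use that in \<open>auto simp: lower_block_def\<close>)
  moreover have "lower_block n (diag_block n c x) = x" if "x \<in> X" for x
    using that X lower_block_diag_block by blast
  moreover have "diag_block n c ` X \<subseteq> carrier_mat (2 * n + 1) (2 * n + 1)"
    using X diag_block_carrier by blast
  ultimately show ?thesis
    using X unfolding variety_iso_def variety_morphism_def
    by (intro conjI exI[of _ "lower_block n"]) auto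
qed

lemma J0_carrier [simp]: "J0 n \<in> carrier_mat (2 * n) (2 * n)"
  unfolding J0_def by (auto simp: mult_2)

lemma J0_transpose: "transpose_mat (J0 n) = J0 n"
  unfolding J0_def by (subst transpose_four_block_mat) auto

lemma J0_square: "J0 n * J0 n = (1\<^sub>m (2 * n) :: 'a :: field mat)"
  unfolding J0_def
  by (subst mult_four_block_mat[of _ n n _ n _ n _ _ n _ n]) (auto simp: mult_2)

lemma J_carrier [simp]: "J n \<in> carrier_mat (2 * n + 1) (2 * n + 1)"
  unfolding J_def by (rule diag_block_carrier) simp

lemma J_transpose: "transpose_mat (J n) = J n"
  unfolding J_def by (simp add: diag_block_transpose J0_transpose)

lemma J_square: "J n * J n = (1\<^sub>m (2 * n + 1) :: 'a :: field mat)"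
  unfolding J_def by (simp add: diag_block_mult J0_square diag_block_one del: add_Suc_right)

lemma theta_lie_carrier [simp]:
  "x \<in> carrier_mat (2 * n + 1) (2 * n + 1) \<Longrightarrow> theta_lie n x \<in> carrier_mat (2 * n + 1) (2 * n + 1)"
  unfolding theta_lie_def using J_carrier[of n] by (metis mult_carrier_mat transpose_carrier_mat)

lemma theta_lie_one: "theta_lie n (1\<^sub>m (2 * n + 1)) = (1\<^sub>m (2 * n + 1) :: 'a :: field mat)"
  unfolding theta_lie_def using J_square[of n] J_carrier[of n] right_mult_one_mat transpose_one by metis

lemma theta_lie_involution:
  fixes x :: "'a :: field mat"
  assumes x: "x \<in> carrier_mat (2 * n + 1) (2 * n + 1)"
  shows "theta_lie n (theta_lie n x) = x"
proof -
  define d where "d = 2 * n + 1"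
  have c: "(J n :: 'a mat) \<in> carrier_mat d d" "x \<in> carrier_mat d d" "J n * J n = (1\<^sub>m d :: 'a mat)"
    using x J_carrier[of n] J_square[of n] by (auto simp: d_def)
  have "theta_lie n (theta_lie n x) = J n * (J n * (x * (J n * J n)))"
    unfolding theta_lie_def using c(1,2)
    by (simp add: transpose_mult[of _ d d _ d] J_transpose assoc_mult_mat[of _ d d _ d _ d]
        mult_carrier_mat[of _ d d])
  then show ?thesis using c by (simp add: mult_mat_cancel_left[of _ d])
qed

text \<open>Transposition reverses the product, and \<open>J n * J n = 1\<close> fits between the
  factors. Being an anti-automorphism, \<open>theta_lie n\<close> becomes the group involution when
  composed with inversion.\<close>

lemma theta_lie_mult:
  fixes x y :: "'a :: field mat"
  assumes "x \<in> carrier_mat (2 * n + 1) (2 * n + 1)" "y \<in> carrier_mat (2 * n + 1) (2 * n + 1)"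
  shows "theta_lie n (x * y) = theta_lie n y * theta_lie n x"
proof -
  define d where "d = 2 * n + 1"
  have c: "(J n :: 'a mat) \<in> carrier_mat d d" "x \<in> carrier_mat d d" "y \<in> carrier_mat d d"
    "J n * J n = (1\<^sub>m d :: 'a mat)"
    using assms J_carrier[of n] J_square[of n] by (auto simp: d_def)
  then show ?thesis
    unfolding theta_lie_def
    by (simp add: transpose_mult[of _ d d] assoc_mult_mat[of _ d d _ d _ d] mult_mat_cancel_left[of _ d])
qed

lemma theta_lie_add:
  fixes x y :: "'a :: field mat"
  assumes "x \<in> carrier_mat (2 * n + 1) (2 * n + 1)" "y \<in> carrier_mat (2 * n + 1) (2 * n + 1)"
  shows "theta_lie n (x + y) = theta_lie n x + theta_lie n y"
proof -
  define d where "d = 2 * n + 1"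
  have c: "(J n :: 'a mat) \<in> carrier_mat d d" "x \<in> carrier_mat d d" "y \<in> carrier_mat d d"
    using assms J_carrier[of n] by (auto simp: d_def)
  then show ?thesis
    unfolding theta_lie_def
    by (simp add: transpose_add[of _ d d] mult_add_distrib_mat[of _ d d _ d]
        add_mult_distrib_mat[of _ d d _ _ d])
qed

lemma theta_lie_diag_block:
  "x \<in> carrier_mat (2 * n) (2 * n) \<Longrightarrow>
    theta_lie n (diag_block n c x) = diag_block n c (J0 n * transpose_mat x * J0 n)"
  unfolding theta_lie_def J_def
  by (simp add: diag_block_transpose diag_block_mult mult_carrier_mat[of _ "2 * n" "2 * n"] del: assoc_mult_mat)

lemma theta_eq:
  assumes g: "g \<in> carrier (GL (2 * n + 1))"
  shows "theta n g = theta_lie n (inv\<^bsub>GL (2 * n + 1)\<^esub> g)"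
  unfolding theta_def theta_lie_def
  by (simp add: GL_right_inverse(2)[OF J_carrier J_carrier J_square] del: One_nat_def add_Suc_right)

lemma G_theta_theta_lie:
  assumes g: "g \<in> G_theta n"
  shows "theta_lie n g = inv\<^bsub>GL (2 * n + 1)\<^esub> g" "theta_lie n (inv\<^bsub>GL (2 * n + 1)\<^esub> g) = g"
proof -
  have G: "g \<in> carrier (GL (2 * n + 1))" using g by (simp add: G_theta_def)
  then show *: "theta_lie n (inv\<^bsub>GL (2 * n + 1)\<^esub> g) = g"
    using g theta_eq[OF G] by (simp add: G_theta_def)
  show "theta_lie n g = inv\<^bsub>GL (2 * n + 1)\<^esub> g"
    using theta_lie_involution[OF GL_carrierD[OF GL_inv(1)[OF G]]] by (simp only: *)
qed

text \<open>Write h for the inverse of g, so that \<open>theta n g\<close> is J h^t J. Multiplying J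
  h^t J = g on the left by g^t J gives the isometry equation; multiplying that equation on the left
  by J h^t leads back.\<close>

lemma G_theta_isometry:
  "G_theta n = {g \<in> carrier (GL (2 * n + 1)). transpose_mat g * J n * g = (J n :: 'a :: field mat)}"
proof -
  define d where "d = 2 * n + 1"
  have "theta n g = g \<longleftrightarrow> transpose_mat g * J n * g = J n" if G: "g \<in> carrier (GL d)" for g :: "'a mat"
  proof -
    define h where "h = inv\<^bsub>GL d\<^esub> g"
    have c: "g \<in> carrier_mat d d" "h \<in> carrier_mat d d" "(J n :: 'a mat) \<in> carrier_mat d d"
      "J n * J n = (1\<^sub>m d :: 'a mat)" "g * h = 1\<^sub>m d" "h * g = 1\<^sub>m d"
      using GL_inv[OF G] G J_carrier[of n] J_square[of n] unfolding h_def d_def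
      by (auto dest: GL_carrierD)
    have t: "transpose_mat g * transpose_mat h = 1\<^sub>m d" "transpose_mat h * transpose_mat g = 1\<^sub>m d"
      using transpose_mult[OF c(1,2)] transpose_mult[OF c(2,1)] c(5,6) transpose_one by metis+
    have th: "theta n g = J n * transpose_mat h * J n"
      using theta_eq G unfolding h_def d_def theta_lie_def by blast
    show ?thesis
    proof
      assume "theta n g = g"
      then have "transpose_mat g * J n * g = transpose_mat g * J n * (J n * transpose_mat h * J n)"
        using th by simp
      also have "\<dots> = J n"
        using c t by (simp add: assoc_mult_mat[of _ d d _ d _ d] mult_mat_cancel_left[of _ d])
      finally show "transpose_mat g * J n * g = J n" .
    next
      assume *: "transpose_mat g * J n * g = J n"
      have "theta n g = J n * transpose_mat h * (transpose_mat g * J n * g)" using th * by simp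
      also have "\<dots> = g"
        using c t by (simp add: assoc_mult_mat[of _ d d _ d _ d] mult_mat_cancel_left[of _ d])
      finally show "theta n g = g" .
    qed
  qed
  then show ?thesis unfolding G_theta_def d_def by blast
qed

text \<open>An anti-automorphism fixing 1 takes inverses to inverses, so \<open>theta n g\<close> is
  the inverse of \<open>theta_lie n g\<close>. Inverting both sides of the defining equation removes
  the inverse from it.\<close>

lemma G_iota_theta_iff:
  fixes g :: "'a :: field mat"
  shows "g \<in> G_iota_theta n \<longleftrightarrow> g \<in> carrier (GL (2 * n + 1)) \<and> theta_lie n g = g"
proof -
  define d where "d = 2 * n + 1"
  have "theta n g = inv\<^bsub>GL d\<^esub> g \<longleftrightarrow> theta_lie n g = g" if G: "g \<in> carrier (GL d)"
  proof -
    define h where "h = inv\<^bsub>GL d\<^esub> g"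
    have c: "g \<in> carrier_mat d d" "h \<in> carrier_mat d d" "g * h = 1\<^sub>m d" "h * g = 1\<^sub>m d"
      "theta_lie n g \<in> carrier_mat d d" "theta_lie n h \<in> carrier_mat d d"
      using GL_inv[OF G] G theta_lie_carrier[of g n] theta_lie_carrier[of h n] unfolding h_def d_def
      by (auto dest: GL_carrierD)
    have "theta_lie n g * theta_lie n h = 1\<^sub>m d"
      using theta_lie_mult[of h n g] theta_lie_one[of n, where 'a = 'a] c unfolding d_def by simp
    then have inv: "inv\<^bsub>GL d\<^esub> (theta_lie n g) = theta_lie n h" "theta_lie n g \<in> carrier (GL d)"
      using GL_right_inverse c by auto
    have "theta n g = theta_lie n h" using theta_eq G unfolding h_def d_def by blast
    then show ?thesis using inv G h_def group.inv_inv[OF group_GL] by metis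
  qed
  then show ?thesis unfolding G_iota_theta_def d_def by blast
qed

text \<open>On \<open>G_theta n\<close> the map \<open>theta_lie n\<close> is inversion. It reverses
  the three factors of g x g^-1 and exchanges the outer two, which puts them back in place.\<close>

lemma theta_lie_conj_action:
  assumes g: "g \<in> G_theta n" and x: "x \<in> carrier_mat (2 * n + 1) (2 * n + 1)"
  shows "theta_lie n (conj_action (2 * n + 1) g x) = conj_action (2 * n + 1) g (theta_lie n x)"
proof -
  define d where "d = 2 * n + 1"
  define h where "h = inv\<^bsub>GL d\<^esub> g"
  have G: "g \<in> carrier (GL d)" using g by (simp add: G_theta_def d_def)
  have c: "g \<in> carrier_mat d d" "h \<in> carrier_mat d d" "x \<in> carrier_mat d d"
      "theta_lie n x \<in> carrier_mat d d"
    using GL_inv[OF G] G theta_lie_carrier[of x n] x unfolding h_def d_def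
    by (auto dest: GL_carrierD)
  have "theta_lie n (g * x * h) = theta_lie n h * (theta_lie n x * theta_lie n g)"
    using theta_lie_mult[of "g * x" n h] theta_lie_mult[of g n x] c unfolding d_def by simp
  also have "\<dots> = g * theta_lie n x * h"
    using G_theta_theta_lie[OF g] c unfolding d_def[symmetric] h_def[symmetric]
    by (simp add: assoc_mult_mat[of _ d d _ d _ d])
  finally show ?thesis unfolding conj_action_def h_def d_def .
qed

section \<open>Isometries in characteristic 2\<close>

lemma char_two_add_self:
  assumes "CHAR('a :: ring_1) = 2"
  shows "x + x = (0 :: 'a)"
proof -
  have "(of_nat 2 :: 'a) = 0" using of_nat_CHAR[where 'a = 'a] assms by simp
  then show ?thesis by (simp flip: mult_2)
qed

text \<open>In characteristic 2 the form \<open>J0\<close> is \<open>U + U\<^sup>t\<close>, hence alternating.\<close>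

lemma J0_alternating:
  fixes M :: "'a :: field mat"
  assumes char: "CHAR('a) = 2" and M: "M \<in> carrier_mat (2 * n) m" and j: "j < m"
  shows "(transpose_mat M * J0 n * M) $$ (j, j) = 0"
proof -
  define U :: "'a mat" where "U = four_block_mat (0\<^sub>m n n) (1\<^sub>m n) (0\<^sub>m n n) (0\<^sub>m n n)"
  have U: "U \<in> carrier_mat (2 * n) (2 * n)" unfolding U_def by (auto simp: mult_2)
  have J0: "J0 n = U + transpose_mat U"
    unfolding J0_def U_def by (intro eq_matI) auto
  define W where "W = transpose_mat M * U * M"
  have W: "W \<in> carrier_mat m m" using M U unfolding W_def by auto
  \<comment> \<open>The diagonal of W + W^t consists of doubled entries.\<close>
  have "transpose_mat M * J0 n * M = W + transpose_mat W"
    unfolding J0 W_def using M U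
    by (simp add: mult_add_distrib_mat[of _ m "2 * n"] add_mult_distrib_mat[of _ m "2 * n" _ _ m]
        transpose_mult[of _ m "2 * n"] transpose_mult[of _ "2 * n" "2 * n"] transpose_mult[of _ "2 * n" m]
        transpose_mult[of _ m "2 * n" _ m])
  then show ?thesis using W j char_two_add_self[OF char] by simp
qed

lemma four_block_mat_eqD:
  assumes "A \<in> carrier_mat r1 c1" "B \<in> carrier_mat r1 c2" "C \<in> carrier_mat r2 c1" "D \<in> carrier_mat r2 c2"
    and "A' \<in> carrier_mat r1 c1" "B' \<in> carrier_mat r1 c2" "C' \<in> carrier_mat r2 c1" "D' \<in> carrier_mat r2 c2"
    and eq: "four_block_mat A B C D = four_block_mat A' B' C' D'"
  shows "A = A'" "B = B'" "C = C'" "D = D'"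
proof -
  have entry: "four_block_mat A B C D $$ (i, j) = four_block_mat A' B' C' D' $$ (i, j)" for i j
    by (simp only: eq)
  show "A = A'"
  proof (intro eq_matI)
    fix i j assume "i < dim_row A'" "j < dim_col A'"
    then show "A $$ (i, j) = A' $$ (i, j)" using entry[of i j] assms(1-8) by auto
  qed (use assms(1-8) in auto)
  show "B = B'"
  proof (intro eq_matI)
    fix i j assume "i < dim_row B'" "j < dim_col B'"
    then show "B $$ (i, j) = B' $$ (i, j)" using entry[of i "j + c1"] assms(1-8) by auto
  qed (use assms(1-8) in auto)
  show "C = C'"
  proof (intro eq_matI)
    fix i j assume "i < dim_row C'" "j < dim_col C'"
    then show "C $$ (i, j) = C' $$ (i, j)" using entry[of "i + r1" j] assms(1-8) by auto
  qed (use assms(1-8) in auto)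
  show "D = D'"
  proof (intro eq_matI)
    fix i j assume "i < dim_row D'" "j < dim_col D'"
    then show "D $$ (i, j) = D' $$ (i, j)" using entry[of "i + r1" "j + c1"] assms(1-8) by auto
  qed (use assms in auto)
qed

lemma J0_diagonal: "j < 2 * n \<Longrightarrow> J0 n $$ (j, j) = 0"
  unfolding J0_def by auto

lemma J_four_block:
  "J n = four_block_mat (1\<^sub>m 1) (0\<^sub>m 1 (2 * n)) (0\<^sub>m (2 * n) 1) (J0 n)"
  unfolding J_def diag_block_def by (intro cong_four_block_mat eq_matI) auto

text \<open>In blocks, (A, C) is the image of e_0 and the columns of (B, D) are the images of the
  basis of V. Preservation of V is B = 0, and C = 0 says that e_0 stays on its line. The isometry
  equation is compared block by block.\<close>

lemma J_isometry_diag_block: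
  fixes g :: "'a :: field mat"
  assumes char: "CHAR('a) = 2" and g: "g \<in> carrier_mat (2 * n + 1) (2 * n + 1)"
    and iso: "transpose_mat g * J n * g = J n"
  obtains y where "y \<in> carrier_mat (2 * n) (2 * n)" "g = diag_block n 1 y"
    "transpose_mat y * J0 n * y = J0 n"
proof -
  let ?m = "2 * n"
  obtain A B C D where "split_block g 1 1 = (A, B, C, D)" by (cases "split_block g 1 1") auto
  from split_block[OF this, of ?m ?m] g
  have c: "A \<in> carrier_mat 1 1" "B \<in> carrier_mat 1 ?m" "C \<in> carrier_mat ?m 1" "D \<in> carrier_mat ?m ?m"
    and gb: "g = four_block_mat A B C D" by auto
  have J0: "(J0 n :: 'a mat) \<in> carrier_mat ?m ?m" by simp
  have J0C: "J0 n * C \<in> carrier_mat ?m 1" and J0D: "J0 n * D \<in> carrier_mat ?m ?m"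
    using mult_carrier_mat[OF J0 c(3)] mult_carrier_mat[OF J0 c(4)] .
  have Jg: "J n * g = four_block_mat A B (J0 n * C) (J0 n * D)"
    unfolding J_four_block gb
    by (subst mult_four_block_mat[of _ 1 1 _ ?m _ ?m _ _ 1 _ ?m])
      (use c J0 in \<open>auto simp: mult_carrier_mat[of _ ?m ?m]\<close>)
  have gJg: "transpose_mat g * (J n * g) = four_block_mat
      (transpose_mat A * A + transpose_mat C * (J0 n * C)) (transpose_mat A * B + transpose_mat C * (J0 n * D))
      (transpose_mat B * A + transpose_mat D * (J0 n * C)) (transpose_mat B * B + transpose_mat D * (J0 n * D))"
    unfolding Jg unfolding gb transpose_four_block_mat[OF c]
    by (rule mult_four_block_mat[of _ 1 1 _ ?m _ ?m _ _ 1 _ ?m]) (use c J0C J0D in auto)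
  have "transpose_mat g * (J n * g) = J n"
    using iso g J_carrier[of n, where 'a = 'a]
      assoc_mult_mat[of "transpose_mat g" "2 * n + 1" "2 * n + 1" "J n" "2 * n + 1" g "2 * n + 1"]
    by simp
  then have eq: "four_block_mat
      (transpose_mat A * A + transpose_mat C * (J0 n * C)) (transpose_mat A * B + transpose_mat C * (J0 n * D))
      (transpose_mat B * A + transpose_mat D * (J0 n * C)) (transpose_mat B * B + transpose_mat D * (J0 n * D))
    = four_block_mat (1\<^sub>m 1) (0\<^sub>m 1 ?m) (0\<^sub>m ?m 1) (J0 n)"
    unfolding gJg unfolding J_four_block .
  have "transpose_mat A * A + transpose_mat C * (J0 n * C) = 1\<^sub>m 1"
    and "transpose_mat B * A + transpose_mat D * (J0 n * C) = 0\<^sub>m ?m 1"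
    and "transpose_mat B * B + transpose_mat D * (J0 n * D) = J0 n"
    by (rule four_block_mat_eqD[OF _ _ _ _ _ _ _ _ eq, of 1 1 ?m ?m];
        use c J0 in \<open>simp add: mult_carrier_mat[of _ 1 1] mult_carrier_mat[of _ 1 ?m]
      mult_carrier_mat[of _ ?m 1] mult_carrier_mat[of _ ?m ?m] add_carrier_mat del: One_nat_def\<close>)+
  then have E11: "transpose_mat A * A + transpose_mat C * J0 n * C = 1\<^sub>m 1"
    and E21: "transpose_mat B * A + transpose_mat D * J0 n * C = 0\<^sub>m ?m 1"
    and E22: "transpose_mat B * B + transpose_mat D * J0 n * D = J0 n"
    using c J0 assoc_mult_mat[of "transpose_mat C" 1 ?m "J0 n" ?m C 1]
      assoc_mult_mat[of "transpose_mat D" ?m ?m "J0 n" ?m C 1]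
      assoc_mult_mat[of "transpose_mat D" ?m ?m "J0 n" ?m D ?m]
    by (simp_all only: transpose_carrier_mat)
  \<comment> \<open>The diagonal of B^t B holds the squares of the entries of B. The other two terms
    of \<open>E22\<close> have zero diagonal, by alternation, so these squares vanish.\<close>
  have B: "B = 0\<^sub>m 1 ?m"
  proof (intro eq_matI)
    fix i j assume "i < dim_row (0\<^sub>m 1 ?m :: 'a mat)" "j < dim_col (0\<^sub>m 1 ?m :: 'a mat)"
    then have i: "i = 0" and j: "j < ?m" by auto
    have "(transpose_mat B * B + transpose_mat D * J0 n * D) $$ (j, j) = 0"
      using E22 J0_diagonal[OF j] by simp
    then have "B $$ (0, j) * B $$ (0, j) = 0"
      using c j J0_alternating[OF char c(4) j] by (simp add: scalar_prod_def del: assoc_mult_mat)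
    then show "B $$ (i, j) = (0\<^sub>m 1 ?m) $$ (i, j)" using i j by simp
  qed (use c in auto)
  \<comment> \<open>Alternation removes the contribution of C, leaving a^2 = 1 for the single entry
    a; its roots 1 and -1 coincide.\<close>
  have A: "A = 1\<^sub>m 1"
  proof (intro eq_matI)
    fix i j assume "i < dim_row (1\<^sub>m 1 :: 'a mat)" "j < dim_col (1\<^sub>m 1 :: 'a mat)"
    then have ij: "i = 0" "j = 0" by auto
    have "(transpose_mat A * A + transpose_mat C * J0 n * C) $$ (0, 0) = 1"
      using E11 by simp
    then have "A $$ (0, 0) * A $$ (0, 0) = 1"
      using c J0_alternating[OF char c(3), of 0] by (simp add: scalar_prod_def del: assoc_mult_mat)
    moreover have "(-1 :: 'a) = 1"
      using char_two_add_self[OF char, of 1] by (simp add: minus_equation_iff eq_neg_iff_add_eq_0)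
    ultimately show "A $$ (i, j) = 1\<^sub>m 1 $$ (i, j)" using ij square_eq_1_iff[of "A $$ (0, 0)"] by auto
  qed (use c in auto)
  have D: "transpose_mat D * J0 n * D = J0 n"
    using E22 B c J0 assoc_mult_mat[of "transpose_mat D" ?m ?m "J0 n" ?m D ?m] by simp
  have DC: "transpose_mat D * (J0 n * C) = 0\<^sub>m ?m 1"
    using E21 B A c J0 mult_carrier_mat[OF _ J0C, of "transpose_mat D" ?m] by simp
  \<comment> \<open>From D^t J0 D = J0 and J0^2 = 1, this is a left inverse of D, hence also a right
    inverse. Then C = D L C contains the factor D^t J0 C, which is 0 by \<open>DC\<close>.\<close>
  let ?L = "J0 n * (transpose_mat D * J0 n)"
  have L: "?L \<in> carrier_mat ?m ?m" using c J0 by (simp add: mult_carrier_mat[of _ ?m ?m])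
  have "?L * D = J0 n * (transpose_mat D * J0 n * D)"
    using c J0 by (simp add: assoc_mult_mat[of _ ?m ?m _ ?m _ ?m] mult_carrier_mat[of _ ?m ?m])
  then have "?L * D = 1\<^sub>m ?m" using D J0_square by simp
  then have DL: "D * ?L = 1\<^sub>m ?m" by (rule mat_mult_left_right_inverse[OF L c(4)])
  have "C = D * ?L * C" using DL c by simp
  also have "\<dots> = D * (J0 n * (transpose_mat D * (J0 n * C)))"
    using c J0 by (simp add: assoc_mult_mat[of _ ?m ?m _ ?m _ 1] assoc_mult_mat[of _ ?m ?m _ ?m _ ?m] mult_carrier_mat[of _ ?m ?m] mult_carrier_mat[of _ ?m ?m _ 1])
  also have "\<dots> = 0\<^sub>m ?m 1" using DC right_mult_zero_mat[OF J0] right_mult_zero_mat[OF c(4)] by simp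
  finally have C: "C = 0\<^sub>m ?m 1" .
  have "g = diag_block n 1 D"
    unfolding gb A B C diag_block_def by (intro cong_four_block_mat eq_matI) auto
  then show thesis using that c(4) D by blast
qed

section \<open>The fixed group as a symplectic group\<close>

lemma subgroup_Sp: "subgroup (Sp n) (GL (2 * n))"
  unfolding Sp_def by (rule subgroup_isometry) simp

lemma subgroup_G_theta: "subgroup (G_theta n) (GL (2 * n + 1))"
  unfolding G_theta_isometry by (rule subgroup_isometry) (rule J_carrier)

lemma Sp_carrier: "Sp n \<subseteq> carrier_mat (2 * n) (2 * n)"
  unfolding Sp_def by (auto dest: GL_carrierD)

lemma diag_block_GL:
  assumes "y \<in> carrier (GL (2 * n))"
  shows "diag_block n 1 y \<in> carrier (GL (2 * n + 1))"
    and "inv\<^bsub>GL (2 * n + 1)\<^esub> (diag_block n 1 y) = diag_block n 1 (inv\<^bsub>GL (2 * n)\<^esub> y)"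
proof -
  have c: "y \<in> carrier_mat (2 * n) (2 * n)" "inv\<^bsub>GL (2 * n)\<^esub> y \<in> carrier_mat (2 * n) (2 * n)"
    using GL_inv(1)[OF assms] assms by (auto dest: GL_carrierD)
  then have "diag_block n 1 y * diag_block n 1 (inv\<^bsub>GL (2 * n)\<^esub> y) = 1\<^sub>m (2 * n + 1)"
    using GL_inv(3)[OF assms] by (simp add: diag_block_mult diag_block_one del: add_Suc_right)
  from GL_right_inverse[OF diag_block_carrier[OF c(1)] diag_block_carrier[OF c(2)] this]
  show "diag_block n 1 y \<in> carrier (GL (2 * n + 1))"
    "inv\<^bsub>GL (2 * n + 1)\<^esub> (diag_block n 1 y) = diag_block n 1 (inv\<^bsub>GL (2 * n)\<^esub> y)" .
qed

lemma G_theta_eq_Sp: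
  assumes char: "CHAR('a :: field) = 2"
  shows "G_theta n = diag_block n 1 ` (Sp n :: 'a mat set)"
proof (intro equalityI subsetI)
  fix g :: "'a mat" assume "g \<in> G_theta n"
  then have G: "g \<in> carrier (GL (2 * n + 1))" and iso: "transpose_mat g * J n * g = J n"
    unfolding G_theta_isometry by auto
  obtain y where y: "y \<in> carrier_mat (2 * n) (2 * n)" "g = diag_block n 1 y"
    "transpose_mat y * J0 n * y = J0 n"
    by (rule J_isometry_diag_block[OF char GL_carrierD[OF G] iso])
  \<comment> \<open>So far y is only a matrix; J0 y^t J0 is the inverse that places it in the
    general linear group.\<close>
  have L: "J0 n * transpose_mat y * J0 n \<in> carrier_mat (2 * n) (2 * n)"
    using y(1) J0_carrier[of n] by (metis mult_carrier_mat transpose_carrier_mat)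
  have "J0 n * transpose_mat y * J0 n * y = J0 n * (transpose_mat y * J0 n * y)"
    using y(1) J0_carrier[of n, where 'a = 'a]
    by (simp add: assoc_mult_mat[of _ "2 * n" "2 * n" _ "2 * n" _ "2 * n"] mult_carrier_mat[of _ "2 * n" "2 * n"])
  then have "J0 n * transpose_mat y * J0 n * y = 1\<^sub>m (2 * n)" using y(3) J0_square by simp
  then have "y \<in> carrier (GL (2 * n))"
    using GL_right_inverse(1)[OF y(1) L mat_mult_left_right_inverse[OF L y(1)]] by blast
  then show "g \<in> diag_block n 1 ` Sp n" using y by (auto simp: Sp_def)
next
  fix g :: "'a mat" assume "g \<in> diag_block n 1 ` Sp n"
  then obtain y where y: "y \<in> carrier (GL (2 * n))" "transpose_mat y * J0 n * y = J0 n"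
    "g = diag_block n 1 y" by (auto simp: Sp_def)
  note c = GL_carrierD[OF y(1)]
  have "transpose_mat g * J n * g = diag_block n 1 (transpose_mat y * J0 n * y)"
    using c J0_carrier[of n, where 'a = 'a] unfolding y(3) J_def
    by (simp add: diag_block_transpose diag_block_mult mult_carrier_mat[of _ "2 * n" "2 * n"] del: assoc_mult_mat)
  then show "g \<in> G_theta n"
    unfolding G_theta_isometry using y diag_block_GL(1)[OF y(1)] by (auto simp: J_def)
qed

lemma algebraic_group_iso_diag_block:
  assumes char: "CHAR('a :: field) = 2"
  shows "algebraic_group_iso (2 * n) (Sp n :: 'a mat set) (2 * n + 1) (G_theta n) (diag_block n 1)"
proof -
  have inj: "inj_on (diag_block n 1) (Sp n :: 'a mat set)"
    using Sp_carrier lower_block_diag_block by (intro inj_on_inverseI[of _ "lower_block n"]) blast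
  have "diag_block n 1 \<in> iso ((GL (2 * n))\<lparr>carrier := Sp n :: 'a mat set\<rparr>)
      ((GL (2 * n + 1))\<lparr>carrier := G_theta n\<rparr>)"
  proof (rule isoI)
    show "diag_block n 1 \<in> hom ((GL (2 * n))\<lparr>carrier := Sp n :: 'a mat set\<rparr>)
        ((GL (2 * n + 1))\<lparr>carrier := G_theta n\<rparr>)"
      using Sp_carrier[of n, where 'a = 'a] G_theta_eq_Sp[OF char, of n]
      by (intro homI) (auto simp: GL_mult diag_block_mult subset_iff simp del: add_Suc_right)
    show "bij_betw (diag_block n 1) (carrier ((GL (2 * n))\<lparr>carrier := Sp n :: 'a mat set\<rparr>))
        (carrier ((GL (2 * n + 1))\<lparr>carrier := G_theta n\<rparr>))"
      using inj G_theta_eq_Sp[OF char, of n] by (simp add: bij_betw_def)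
  qed
  moreover have "variety_iso (2 * n) (Sp n :: 'a mat set) (2 * n + 1) (G_theta n) (diag_block n 1)"
    unfolding G_theta_eq_Sp[OF char] by (rule variety_iso_diag_block[OF Sp_carrier])
  ultimately show ?thesis
    unfolding algebraic_group_iso_def using subgroup_Sp subgroup_G_theta by blast
qed

section \<open>From unipotent to nilpotent elements\<close>

lemma equivariant_iso_minus_one:
  "equivariant_variety_iso (2 * n + 1) (G_theta n :: 'a :: field mat set)
    (G_iota_theta_uni n) (g_theta_nil n) (\<lambda>g. g - 1\<^sub>m (2 * n + 1))"
proof -
  define d where "d = 2 * n + 1"
  let ?X = "G_iota_theta_uni n :: 'a mat set" and ?Y = "g_theta_nil n :: 'a mat set"
  have X: "x \<in> ?X \<longleftrightarrow> x \<in> carrier (GL d) \<and> theta_lie n x = x \<and> nilpotent_mat d (x - 1\<^sub>m d)" for x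
    by (auto simp: G_iota_theta_uni_def G_iota_theta_iff unipotent_mat_def d_def)
  have Y: "y \<in> ?Y \<longleftrightarrow> y \<in> carrier_mat d d \<and> theta_lie n y = y \<and> nilpotent_mat d y" for y
    by (auto simp: g_theta_nil_def g_theta_def d_def)
  have GT: "g \<in> carrier (GL d)" if "g \<in> G_theta n" for g :: "'a mat"
    using that by (simp add: G_theta_def d_def)
  have sub: "?X \<subseteq> carrier_mat d d" "?Y \<subseteq> carrier_mat d d"
    using X Y by (auto dest: GL_carrierD)
  have cancel: "x - 1\<^sub>m d + 1\<^sub>m d = x" "x + 1\<^sub>m d - 1\<^sub>m d = x" if "x \<in> carrier_mat d d" for x :: "'a mat"
    using that by (intro eq_matI; auto)+
  have add: "theta_lie n (x + 1\<^sub>m d) = theta_lie n x + 1\<^sub>m d" if "x \<in> carrier_mat d d" for x :: "'a mat"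
    using theta_lie_add[of x n "1\<^sub>m d"] theta_lie_one[of n, where 'a = 'a] that
    by (simp add: d_def del: add_Suc_right)
  have fwd: "x - 1\<^sub>m d \<in> ?Y" if "x \<in> ?X" for x
  proof -
    have x: "x \<in> carrier_mat d d" "theta_lie n x = x" using that X by (auto dest: GL_carrierD)
    then have x1: "x - 1\<^sub>m d \<in> carrier_mat d d" by auto
    \<comment> \<open>Adding and removing 1 reduces the difference to additivity and to the fixed
      point 1.\<close>
    have "theta_lie n (x - 1\<^sub>m d) = theta_lie n (x - 1\<^sub>m d) + 1\<^sub>m d - 1\<^sub>m d"
      using cancel(2) theta_lie_carrier[of "x - 1\<^sub>m d" n] x1 unfolding d_def by metis
    also have "\<dots> = x - 1\<^sub>m d" using add[OF x1] cancel(1)[OF x(1)] x(2) by simp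
    finally show ?thesis using that X Y x1 by blast
  qed
  have bwd: "y + 1\<^sub>m d \<in> ?X" if "y \<in> ?Y" for y
    using that X Y one_plus_nilpotent_unit[of y d] add[of y] cancel(2)[of y] by auto
  have "variety_iso d ?X d ?Y (\<lambda>x. x - 1\<^sub>m d)"
    unfolding variety_iso_def variety_morphism_def
  proof (intro conjI exI[of _ "\<lambda>y. y + 1\<^sub>m d"] allI impI ballI)
    fix i j assume ij: "i < d" "j < d"
    show "regular_on d ?X (\<lambda>x. (x - 1\<^sub>m d) $$ (i, j))"
      by (rule regular_on_poly[OF poly_funs.add[OF poly_funs.coord[OF ij] poly_funs.const,
            of "- (1\<^sub>m d $$ (i, j))"]]) (use ij in auto)
    show "regular_on d ?Y (\<lambda>x. (x + 1\<^sub>m d) $$ (i, j))"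
      by (rule regular_on_poly[OF poly_funs.add[OF poly_funs.coord[OF ij] poly_funs.const,
            of "1\<^sub>m d $$ (i, j)"]]) (use ij in auto)
  qed (use sub fwd bwd cancel in auto)
  moreover have "conj_action d g x \<in> ?X" if g: "g \<in> G_theta n" and x: "x \<in> ?X" for g x
  proof -
    have x': "x \<in> carrier (GL d)" "x \<in> carrier_mat d d" "theta_lie n x = x"
      "nilpotent_mat d (x - 1\<^sub>m d)" "x - 1\<^sub>m d \<in> carrier_mat d d"
      using x X[of x] fwd[OF x] sub by (auto dest: GL_carrierD)
    have "conj_action d g x = g \<otimes>\<^bsub>GL d\<^esub> x \<otimes>\<^bsub>GL d\<^esub> inv\<^bsub>GL d\<^esub> g"
      by (simp add: conj_action_def GL_mult)
    moreover have "\<dots> \<in> carrier (GL d)"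
      using monoid.m_closed[OF group.is_monoid[OF group_GL]] x'(1) GT[OF g] GL_inv(1)[OF GT[OF g]]
      by blast
    moreover have "theta_lie n (conj_action d g x) = conj_action d g x"
      using theta_lie_conj_action[OF g] x'(2,3) unfolding d_def by metis
    moreover have "nilpotent_mat d (conj_action d g x - 1\<^sub>m d)"
      using nilpotent_conj_action[OF GT[OF g] x'(5,4)] conj_action_minus_one[OF GT[OF g] x'(2)]
      by simp
    ultimately show ?thesis using X by metis
  qed
  moreover have "conj_action d g y \<in> ?Y" if g: "g \<in> G_theta n" and y: "y \<in> ?Y" for g y
  proof -
    have y': "y \<in> carrier_mat d d" "theta_lie n y = y" "nilpotent_mat d y" using y Y by blast+
    have "theta_lie n (conj_action d g y) = conj_action d g y"
      using theta_lie_conj_action[OF g] y'(1,2) unfolding d_def by metis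
    then show ?thesis
      using Y conj_action_carrier[OF GT[OF g] y'(1)] nilpotent_conj_action[OF GT[OF g] y'(1,3)] by blast
  qed
  moreover have "conj_action d g x - 1\<^sub>m d = conj_action d g (x - 1\<^sub>m d)"
    if g: "g \<in> G_theta n" and x: "x \<in> ?X" for g x
    using conj_action_minus_one[OF GT[OF g], of x] x sub by (metis subsetD)
  ultimately show ?thesis unfolding equivariant_variety_iso_def d_def by blast
qed

section \<open>The symplectic Lie algebra and its nilpotent elements\<close>

lemma sp_carrier: "sp n \<subseteq> carrier_mat (2 * n) (2 * n)"
  unfolding sp_def lie_algebra_def by auto

lemma sp_diag_block_g_theta:
  fixes x :: "'a :: field mat"
  assumes char: "CHAR('a) = 2" and x: "x \<in> sp n"
  shows "diag_block n 0 x \<in> g_theta n"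
proof -
  let ?m = "2 * n"
  have c: "x \<in> carrier_mat ?m ?m" "(J0 n :: 'a mat) \<in> carrier_mat ?m ?m"
    using x sp_carrier J0_carrier by auto
  have "transpose_mat x * J0 n + J0 n * x = 0\<^sub>m ?m ?m"
    using x unfolding sp_def
    by (intro lie_algebra_isometry[OF c(2) Sp_carrier]) (auto simp: Sp_def)
  have eq: "transpose_mat x * J0 n = J0 n * x"
  proof (intro eq_matI)
    fix i j assume "i < dim_row (J0 n * x)" "j < dim_col (J0 n * x)"
    then have ij: "i < ?m" "j < ?m" using c by auto
    have "(transpose_mat x * J0 n + J0 n * x) $$ (i, j) = (0 :: 'a)"
      using \<open>transpose_mat x * J0 n + J0 n * x = 0\<^sub>m ?m ?m\<close> ij by simp
    then have "(transpose_mat x * J0 n) $$ (i, j) + (J0 n * x) $$ (i, j) = 0"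
      using ij c by (simp del: index_mult_mat(1))
    then show "(transpose_mat x * J0 n) $$ (i, j) = (J0 n * x) $$ (i, j)"
      \<comment> \<open>Both a + b and b + b vanish, so a = b: this is where the sign is
        lost.\<close>
      using char_two_add_self[OF char, of "(J0 n * x) $$ (i, j)"] by (metis add_right_cancel)
  qed (use c(1) carrier_matD[OF c(2)] in auto)
  have "J0 n * transpose_mat x * J0 n = J0 n * (J0 n * x)"
    using c eq by (simp add: assoc_mult_mat[of _ ?m ?m _ ?m _ ?m])
  also have "\<dots> = x" using c J0_square by (intro mult_mat_cancel_left[of _ ?m]) auto
  finally show ?thesis
    unfolding g_theta_def using c theta_lie_diag_block[OF c(1), of 0] diag_block_carrier[OF c(1)]
    by (simp del: assoc_mult_mat)
qed

lemma nilpotent_diag_block: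
  assumes x: "x \<in> carrier_mat (2 * n) (2 * n)" and nil: "nilpotent_mat (2 * n) x"
  shows "nilpotent_mat (2 * n + 1) (diag_block n 0 x)"
proof -
  obtain m where "x ^\<^sub>m m = 0\<^sub>m (2 * n) (2 * n)" using nil by (auto simp: nilpotent_mat_def)
  \<comment> \<open>The corner of the m-th power is 0^m, which is 1 when m = 0. Raising the exponent
    by one covers that case, which occurs for n = 0.\<close>
  then have "diag_block n 0 x ^\<^sub>m Suc m = 0\<^sub>m (2 * n + 1) (2 * n + 1)"
    using x by (subst diag_block_pow[OF x]) (simp add: diag_block_zero del: add_Suc_right)
  then show ?thesis unfolding nilpotent_mat_def by blast
qed

text \<open>As a subgroup, \<open>Sp n\<close> is stable under conjugation by its own elements, so
  the transport of derivations applies; nilpotency survives because powers commute with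
  conjugation.\<close>

lemma sp_nil_conj_action:
  assumes y: "y \<in> Sp n" and x: "x \<in> sp_nil n"
  shows "conj_action (2 * n) y x \<in> sp_nil n"
proof -
  have Y: "y \<in> carrier (GL (2 * n))" using y by (simp add: Sp_def)
  have "conj_action (2 * n) y h \<in> Sp n" if "h \<in> Sp n" for h
    using subgroup.m_closed[OF subgroup_Sp subgroup.m_closed[OF subgroup_Sp y that]
        subgroup.m_inv_closed[OF subgroup_Sp y]]
    by (simp add: conj_action_def GL_mult)
  then have "conj_action (2 * n) y x \<in> sp n"
    using x conj_action_lie_algebra[OF Y Sp_carrier] by (simp add: sp_nil_def sp_def)
  then show ?thesis
    using x nilpotent_conj_action[OF Y] sp_carrier by (auto simp: sp_nil_def)
qed

lemma conj_action_diag_block: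
  assumes y: "y \<in> carrier (GL (2 * n))" and x: "x \<in> carrier_mat (2 * n) (2 * n)"
  shows "conj_action (2 * n + 1) (diag_block n 1 y) (diag_block n c x)
    = diag_block n c (conj_action (2 * n) y x)"
proof -
  have c: "y \<in> carrier_mat (2 * n) (2 * n)" "inv\<^bsub>GL (2 * n)\<^esub> y \<in> carrier_mat (2 * n) (2 * n)"
    "y * x \<in> carrier_mat (2 * n) (2 * n)"
    using GL_inv(1)[OF y] y x by (auto dest!: GL_carrierD)
  then show ?thesis
    unfolding conj_action_def diag_block_GL(2)[OF y] using x
    by (simp add: diag_block_mult del: assoc_mult_mat)
qed

theorem proposition1p13:
  fixes n :: nat
  assumes "CHAR('a :: alg_closed_field) = 2"
    and "n \<ge> 1"
  shows "algebraic_group_iso (2 * n) (Sp n :: 'a mat set) (2 * n + 1) (G_theta n)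
           (diag_block n 1)
    \<and> (\<exists>\<phi>. equivariant_variety_iso (2 * n + 1) (G_theta n :: 'a mat set)
           (G_iota_theta_uni n) (g_theta_nil n) \<phi>)
    \<and> (diag_block n 0 ` (sp n :: 'a mat set) \<subseteq> g_theta n
       \<and> diag_block n 0 ` (sp_nil n :: 'a mat set) \<subseteq> g_theta_nil n
       \<and> variety_iso (2 * n) (sp_nil n :: 'a mat set) (2 * n + 1) (diag_block n 0 ` sp_nil n)
           (diag_block n 0))
    \<and> (\<forall>g \<in> (G_theta n :: 'a mat set). \<forall>z \<in> diag_block n 0 ` sp_nil n.
           conj_action (2 * n + 1) g z \<in> diag_block n 0 ` sp_nil n)
    \<and> (\<forall>y \<in> (Sp n :: 'a mat set). \<forall>x \<in> sp_nil n.
           conj_action (2 * n) y x \<in> sp_nil n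
         \<and> conj_action (2 * n + 1) (diag_block n 1 y) (diag_block n 0 x)
             = diag_block n 0 (conj_action (2 * n) y x))"
proof -
  note char = assms(1)
  have sub: "(sp_nil n :: 'a mat set) \<subseteq> carrier_mat (2 * n) (2 * n)"
    using sp_carrier by (auto simp: sp_nil_def)
  have compat: "conj_action (2 * n + 1) (diag_block n 1 y) (diag_block n 0 x)
      = diag_block n 0 (conj_action (2 * n) y x)"
    if "y \<in> Sp n" "x \<in> sp_nil n" for x y :: "'a mat"
    using that sub by (intro conj_action_diag_block) (auto simp: Sp_def)
  have sp: "diag_block n 0 ` (sp n :: 'a mat set) \<subseteq> g_theta n"
    using sp_diag_block_g_theta[OF char] by blast
  then have "diag_block n 0 ` (sp_nil n :: 'a mat set) \<subseteq> g_theta_nil n"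
    using nilpotent_diag_block sub unfolding sp_nil_def g_theta_nil_def by blast
  moreover have "conj_action (2 * n + 1) g z \<in> diag_block n 0 ` sp_nil n"
    if g: "g \<in> G_theta n" and z: "z \<in> diag_block n 0 ` sp_nil n" for g z :: "'a mat"
  proof -
    \<comment> \<open>Every element of \<open>G_theta n\<close> comes from \<open>Sp n\<close>, so
      stability of the image reduces to stability of \<open>sp_nil n\<close>.\<close>
    obtain x y where "g = diag_block n 1 y" "y \<in> Sp n" "z = diag_block n 0 x" "x \<in> sp_nil n"
      using g z unfolding G_theta_eq_Sp[OF char] by blast
    then show ?thesis using compat sp_nil_conj_action[of y n x] by auto
  qed
  ultimately show ?thesis
    using sp compat sp_nil_conj_action
    by (intro conjI algebraic_group_iso_diag_block[OF char]
        variety_iso_diag_block[OF sub] exI[of _ "\<lambda>g. g - 1\<^sub>m (2 * n + 1)"]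
        equivariant_iso_minus_one ballI) (blast intro: sp_nil_conj_action)+
qed

end
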